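(* Let $n$ be a square-free positive composite integer and let $k$ be a positive integer. The following are equivalent: (i) $n$ is a $k$-Carmichael number. (ii) For every prime divisor $p$ of $n$, $p-1$ divides $k(n-1)$. (iii) For every integer $a$, $a^{kn} \equiv a^k \pmod n$.
   Context: $\lambda$ denotes the Carmichael function: $\lambda(n)$ is the exponent of the group $(\mathbb{Z}/n\mathbb{Z})^\times$. For a positive integer $k$, a positive integer $n$ is a $k$-Carmichael number if $\lambda(n)$ divides $k(n-1)$. *)

theory Defs
  imports "HOL-Number_Theory.Number_Theory" "HOL-Computational_Algebra.Squarefree"
begin

text \<open>
  The library constant \<^const>\<open>Carmichael\<close> is the LCM of the orders of the
  residues coprime to \<open>n\<close>, which is the exponent of the unit group of \<open>\<int>/n\<int>\<close>.
  The conjunct \<open>n > 0\<close> makes the subtraction on naturals exact.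
\<close>

definition k_Carmichael :: "nat \<Rightarrow> nat \<Rightarrow> bool" where
  "k_Carmichael k n \<longleftrightarrow> k > 0 \<and> n > 0 \<and> Carmichael n dvd k * (n - 1)"

end

theory Submission
  imports Defs
begin

text \<open>
  For square-free \<open>n\<close>, Carmichael's function is the LCM of the numbers \<open>p - 1\<close> over the primes
  \<open>p\<close> dividing \<open>n\<close>, and a congruence modulo \<open>n\<close> is the conjunction of the congruences modulo
  these \<open>p\<close>. Since \<open>k * n = k + k * (n - 1)\<close>, condition (iii) becomes \<open>a^(k + d) = a^k\<close> modulo every
  such \<open>p\<close>, where \<open>d = k * (n - 1)\<close>: this is clear if \<open>p - 1\<close> divides \<open>d\<close>, and a primitive root
  modulo \<open>p\<close> gives the converse.
\<close>

lemma squarefree_eq_prod_prime_factors: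
  fixes n :: nat
  assumes "squarefree n"
  shows "n = (\<Prod>p\<in>prime_factors n. p)"
proof -
  have n: "n > 0"
    using assms by (cases "n = 0") auto
  have "n = (\<Prod>p\<in>prime_factors n. p ^ multiplicity p n)"
    using n by (simp add: prod_prime_factors)
  \<comment> \<open>Square-freeness forces every multiplicity to be 1.\<close>
  also have "\<dots> = (\<Prod>p\<in>prime_factors n. p)"
    using assms n by (intro prod.cong) (auto simp: squarefree_factorial_semiring')
  finally show ?thesis .
qed

text \<open>Carmichael's function sends a product of pairwise coprime factors to the LCM of its
  values at the factors, and its value at a prime \<open>p\<close> is \<open>p - 1\<close>.\<close>

lemma Carmichael_squarefree:
  assumes "squarefree n"
  shows "Carmichael n = (LCM p\<in>prime_factors n. p - 1)"
proof -
  have "Carmichael n = (LCM p\<in>prime_factors n. Carmichael p)"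
    by (subst (1) squarefree_eq_prod_prime_factors[OF assms], subst Carmichael_prod_coprime)
       (auto intro: primes_coprime)
  also have "\<dots> = (LCM p\<in>prime_factors n. p - 1)"
    by (intro arg_cong[where f = Lcm] image_cong) (auto simp: Carmichael_prime dest: in_prime_factors_imp_prime)
  finally show ?thesis .
qed

lemma cong_squarefree_iff:
  fixes n x y :: nat
  assumes "squarefree n"
  shows "[x = y] (mod n) \<longleftrightarrow> (\<forall>p. prime p \<and> p dvd n \<longrightarrow> [x = y] (mod p))"
proof
  assume "[x = y] (mod n)"
  then show "\<forall>p. prime p \<and> p dvd n \<longrightarrow> [x = y] (mod p)"
    by (auto intro: cong_dvd_modulus_nat)
next
  assume "\<forall>p. prime p \<and> p dvd n \<longrightarrow> [x = y] (mod p)"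
  \<comment> \<open>Distinct primes are coprime, so the congruences combine to one modulo their
    product, which is \<open>n\<close>.\<close>
  then have "[x = y] (mod (\<Prod>p\<in>prime_factors n. p))"
    by (intro coprime_cong_prod_nat) (auto intro: primes_coprime)
  then show "[x = y] (mod n)"
    by (subst squarefree_eq_prod_prime_factors[OF assms])
qed

lemma power_add_cong_prime_iff:
  fixes p k d :: nat
  assumes p: "prime p" and "k > 0"
  shows "(\<forall>a::nat. [a ^ (k + d) = a ^ k] (mod p)) \<longleftrightarrow> (p - 1) dvd d"
proof
  assume *: "\<forall>a::nat. [a ^ (k + d) = a ^ k] (mod p)"
  obtain g where "residue_primroot p g"
    using prime_primitive_root_exists[OF prime_gt_1_nat[OF p] p] by blast
  then have g: "coprime p g" "ord p g = p - 1"
    using p by (auto simp: residue_primroot_def totient_prime)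
  \<comment> \<open>The single instance \<open>a = g\<close> suffices: \<open>g ^ k\<close> is a
    unit modulo \<open>p\<close> and cancels, and \<open>g\<close> has order exactly
    \<open>p - 1\<close>.\<close>
  have "[g ^ k * g ^ d = g ^ k * 1] (mod p)"
    using *[rule_format, of g] by (simp add: power_add)
  then have "[g ^ d = 1] (mod p)"
    using g by (subst (asm) cong_mult_lcancel_nat) (auto simp: coprime_commute)
  then show "(p - 1) dvd d"
    using g by (simp add: ord_divides')
next
  assume d: "(p - 1) dvd d"
  show "\<forall>a::nat. [a ^ (k + d) = a ^ k] (mod p)"
  proof
    fix a :: nat
    show "[a ^ (k + d) = a ^ k] (mod p)"
    proof (cases "p dvd a")
      case True
      \<comment> \<open>Both powers vanish modulo \<open>p\<close> because the exponents are
        positive; \<open>a ^ 0\<close> would be 1.\<close>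
      then have "p dvd a ^ (k + d)" "p dvd a ^ k"
        using \<open>k > 0\<close> by (auto intro: dvd_power_le[of p a 1, simplified] dvd_trans[OF _ dvd_power])
      then show ?thesis
        by (simp add: cong_def mod_eq_0_iff_dvd)
    next
      case False
      \<comment> \<open>Fermat's little theorem, as \<open>d\<close> is a multiple of
        \<open>p - 1\<close>.\<close>
      then have "[a ^ d = 1] (mod p)"
        using d p by (intro Carmichael_divides) (auto simp: Carmichael_prime prime_imp_coprime)
      then have "[a ^ k * a ^ d = a ^ k * 1] (mod p)"
        by (rule cong_scalar_left)
      then show ?thesis
        by (simp add: power_add)
    qed
  qed
qed

text \<open>Bridges condition (iii), stated over the integers, and the criteria above over the
  naturals: each integer is congruent to its least non-negative residue.\<close>

lemma all_int_power_cong_iff_nat: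
  fixes n i j :: nat
  assumes "n > 0"
  shows "(\<forall>a::int. [a ^ i = a ^ j] (mod int n)) \<longleftrightarrow> (\<forall>a::nat. [a ^ i = a ^ j] (mod n))"
proof
  assume *: "\<forall>a::int. [a ^ i = a ^ j] (mod int n)"
  show "\<forall>a::nat. [a ^ i = a ^ j] (mod n)"
  proof
    fix a :: nat
    show "[a ^ i = a ^ j] (mod n)"
      using *[rule_format, of "int a"] by (simp flip: cong_int_iff)
  qed
next
  assume *: "\<forall>a::nat. [a ^ i = a ^ j] (mod n)"
  show "\<forall>a::int. [a ^ i = a ^ j] (mod int n)"
  proof
    fix a :: int
    define b where "b = nat (a mod int n)"
    have b: "[a = int b] (mod int n)"
      using assms by (simp add: b_def)
    have "[int b ^ i = int b ^ j] (mod int n)"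
      using *[rule_format, of b] by (simp flip: cong_int_iff)
    then show "[a ^ i = a ^ j] (mod int n)"
      by (meson b cong_pow cong_sym cong_trans)
  qed
qed

theorem proposition6:
  fixes n k :: nat
  assumes "squarefree n" and "n > 1" and "\<not> prime n" and "k > 0"
  shows "(k_Carmichael k n \<longleftrightarrow> (\<forall>p. prime p \<and> p dvd n \<longrightarrow> (p - 1) dvd k * (n - 1))) \<and>
         ((\<forall>p. prime p \<and> p dvd n \<longrightarrow> (p - 1) dvd k * (n - 1)) \<longleftrightarrow>
            (\<forall>a::int. [a ^ (k * n) = a ^ k] (mod int n)))"
proof
  show "k_Carmichael k n \<longleftrightarrow> (\<forall>p. prime p \<and> p dvd n \<longrightarrow> (p - 1) dvd k * (n - 1))"
    using assms
    by (auto simp: k_Carmichael_def Carmichael_squarefree Lcm_dvd_iff prime_factors_dvd)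
next
  have kn: "k * n = k + k * (n - 1)"
    using \<open>n > 1\<close> by (cases n) auto
  have "(\<forall>a::int. [a ^ (k * n) = a ^ k] (mod int n)) \<longleftrightarrow>
        (\<forall>a::nat. [a ^ (k * n) = a ^ k] (mod n))"
    using \<open>n > 1\<close> by (intro all_int_power_cong_iff_nat) simp
  also have "\<dots> \<longleftrightarrow>
        (\<forall>p. prime p \<and> p dvd n \<longrightarrow> (\<forall>a::nat. [a ^ (k + k * (n - 1)) = a ^ k] (mod p)))"
    \<comment> \<open>After splitting the modulus into primes, the quantifiers over \<open>a\<close>
      and \<open>p\<close> are exchanged, so that each prime can be treated separately.\<close>
    unfolding kn cong_squarefree_iff[OF \<open>squarefree n\<close>] by blast
  also have "\<dots> \<longleftrightarrow> (\<forall>p. prime p \<and> p dvd n \<longrightarrow> (p - 1) dvd k * (n - 1))"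
    using power_add_cong_prime_iff[OF _ \<open>k > 0\<close>] by blast
  finally show "(\<forall>p. prime p \<and> p dvd n \<longrightarrow> (p - 1) dvd k * (n - 1)) \<longleftrightarrow>
        (\<forall>a::int. [a ^ (k * n) = a ^ k] (mod int n))" ..
qed

end
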